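(* Let $\mathcal{A}$ be an abelian category with enough projectives and let $M$ and $N$ be two objects of $\mathcal{A}$. The following conditions are equivalent. 1. $N\in\underline{\mathfrak{Pr}}^{-1}_{\mathcal{A}}(M)$. 2. For every epimorphism $g:K\to N$ and every morphism $f:M\to N$, the epimorphism $g':D\to M$ given by the pullback $(D,g',f')$ of $g$ and $f$ splits. 3. There exists an epimorphism $g:P\to N$ with $P$ projective such that for every morphism $f:M\to N$ the epimorphism $g':D\to M$ given by the pullback $(D,g',f')$ of $g$ and $f$ splits. 4. There exists an epimorphism $g:P\to N$ with $P\in\underline{\mathfrak{Pr}}^{-1}_{\mathcal{A}}(M)$ such that for every morphism $f:M\to N$ the epimorphism $g':D\to M$ given by the pullback $(D,g',f')$ of $g$ and $f$ splits.
   Context: Subprojectivity: in an abelian category $\mathcal{A}$ with enough projectives, $M$ is $N$-subprojective if for every epimorphism $g:B\to N$ and every morphism $f:M\to N$ there is a morphism $h:M\to B$ with $gh=f$. The subprojectivity domain of $M$ is $\underline{\mathfrak{Pr}}^{-1}_{\mathcal{A}}(M)=\{N\in\mathcal{A} : M \text{ is } N\text{-subprojective}\}$. The pullback of $g:C\to B$ and $f:A\to B$ is denoted $(D,g',f')$, with $g':D\to A$, $f':D\to C$ and $fg'=gf'$. An epimorphism $g':D\to M$ splits if there is $k:M\to D$ with $g'k=\mathrm{id}_M$. *)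

theory Defs
  imports "HOL-Algebra.Group"
begin

record ('o, 'a) category =
  Obj :: "'o set"
  Arr :: "'a set"
  Dom :: "'a \<Rightarrow> 'o"
  Cod :: "'a \<Rightarrow> 'o"
  Ide :: "'o \<Rightarrow> 'a"
  Comp :: "'a \<Rightarrow> 'a \<Rightarrow> 'a"  (infixr "\<cdot>\<index>" 75)

definition Hom :: "('o, 'a, 'm) category_scheme \<Rightarrow> 'o \<Rightarrow> 'o \<Rightarrow> 'a set" where
  "Hom C A B = {f \<in> Arr C. Dom C f = A \<and> Cod C f = B}"

locale category =
  fixes C :: "('o, 'a, 'm) category_scheme" (structure)
  assumes Dom_closed: "f \<in> Arr C \<Longrightarrow> Dom C f \<in> Obj C"
    and Cod_closed: "f \<in> Arr C \<Longrightarrow> Cod C f \<in> Obj C"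
    and Ide_closed: "A \<in> Obj C \<Longrightarrow> Ide C A \<in> Hom C A A"
    and Comp_closed: "f \<in> Hom C X Y \<Longrightarrow> g \<in> Hom C Y Z \<Longrightarrow> g \<cdot> f \<in> Hom C X Z"
    and Comp_Ide: "f \<in> Hom C X Y \<Longrightarrow> f \<cdot> Ide C X = f"
    and Ide_Comp: "f \<in> Hom C X Y \<Longrightarrow> Ide C Y \<cdot> f = f"
    and Comp_assoc:
      "f \<in> Hom C W X \<Longrightarrow> g \<in> Hom C X Y \<Longrightarrow> h \<in> Hom C Y Z \<Longrightarrow> (h \<cdot> g) \<cdot> f = h \<cdot> (g \<cdot> f)"

definition monic :: "('o, 'a, 'm) category_scheme \<Rightarrow> 'a \<Rightarrow> bool" where
  "monic C f \<longleftrightarrow> f \<in> Arr C \<and>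
     (\<forall>X \<in> Obj C. \<forall>u \<in> Hom C X (Dom C f). \<forall>v \<in> Hom C X (Dom C f).
        f \<cdot>\<^bsub>C\<^esub> u = f \<cdot>\<^bsub>C\<^esub> v \<longrightarrow> u = v)"

definition epic :: "('o, 'a, 'm) category_scheme \<Rightarrow> 'a \<Rightarrow> bool" where
  "epic C f \<longleftrightarrow> f \<in> Arr C \<and>
     (\<forall>X \<in> Obj C. \<forall>u \<in> Hom C (Cod C f) X. \<forall>v \<in> Hom C (Cod C f) X.
        u \<cdot>\<^bsub>C\<^esub> f = v \<cdot>\<^bsub>C\<^esub> f \<longrightarrow> u = v)"

definition split_epic :: "('o, 'a, 'm) category_scheme \<Rightarrow> 'a \<Rightarrow> bool" where
  "split_epic C f \<longleftrightarrow> epic C f \<and>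
     (\<exists>k \<in> Hom C (Cod C f) (Dom C f). f \<cdot>\<^bsub>C\<^esub> k = Ide C (Cod C f))"

definition is_zero_object :: "('o, 'a, 'm) category_scheme \<Rightarrow> 'o \<Rightarrow> bool" where
  "is_zero_object C Z \<longleftrightarrow> Z \<in> Obj C \<and>
     (\<forall>X \<in> Obj C. (\<exists>!f. f \<in> Hom C Z X) \<and> (\<exists>!f. f \<in> Hom C X Z))"

definition is_product ::
  "('o, 'a, 'm) category_scheme \<Rightarrow> 'o \<Rightarrow> 'o \<Rightarrow> 'o \<Rightarrow> 'a \<Rightarrow> 'a \<Rightarrow> bool" where
  "is_product C A B P p q \<longleftrightarrow> p \<in> Hom C P A \<and> q \<in> Hom C P B \<and>
     (\<forall>X \<in> Obj C. \<forall>a \<in> Hom C X A. \<forall>b \<in> Hom C X B.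
        \<exists>!u. u \<in> Hom C X P \<and> p \<cdot>\<^bsub>C\<^esub> u = a \<and> q \<cdot>\<^bsub>C\<^esub> u = b)"

text \<open>The argument order is that of ``the pullback \<open>(D, g', f')\<close> of \<open>g : K \<rightarrow> B\<close> and
  \<open>f : A \<rightarrow> B\<close>'', where \<open>g' : D \<rightarrow> A\<close> is opposite \<open>g\<close> and \<open>f' : D \<rightarrow> K\<close> is opposite \<open>f\<close>.\<close>

definition is_pullback ::
  "('o, 'a, 'm) category_scheme \<Rightarrow> 'a \<Rightarrow> 'a \<Rightarrow> 'o \<Rightarrow> 'a \<Rightarrow> 'a \<Rightarrow> bool" where
  "is_pullback C g f D g' f' \<longleftrightarrow>
     g \<in> Arr C \<and> f \<in> Arr C \<and> Cod C g = Cod C f \<and>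
     g' \<in> Hom C D (Dom C f) \<and> f' \<in> Hom C D (Dom C g) \<and>
     f \<cdot>\<^bsub>C\<^esub> g' = g \<cdot>\<^bsub>C\<^esub> f' \<and>
     (\<forall>X \<in> Obj C. \<forall>a \<in> Hom C X (Dom C f). \<forall>c \<in> Hom C X (Dom C g).
        f \<cdot>\<^bsub>C\<^esub> a = g \<cdot>\<^bsub>C\<^esub> c \<longrightarrow>
        (\<exists>!u. u \<in> Hom C X D \<and> g' \<cdot>\<^bsub>C\<^esub> u = a \<and> f' \<cdot>\<^bsub>C\<^esub> u = c))"

definition projective :: "('o, 'a, 'm) category_scheme \<Rightarrow> 'o \<Rightarrow> bool" where
  "projective C P \<longleftrightarrow> P \<in> Obj C \<and>
     (\<forall>A \<in> Obj C. \<forall>B \<in> Obj C. \<forall>g \<in> Hom C A B. epic C g \<longrightarrow>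
        (\<forall>f \<in> Hom C P B. \<exists>h \<in> Hom C P A. g \<cdot>\<^bsub>C\<^esub> h = f))"

definition enough_projectives :: "('o, 'a, 'm) category_scheme \<Rightarrow> bool" where
  "enough_projectives C \<longleftrightarrow>
     (\<forall>X \<in> Obj C. \<exists>P p. projective C P \<and> p \<in> Hom C P X \<and> epic C p)"

definition subprojective :: "('o, 'a, 'm) category_scheme \<Rightarrow> 'o \<Rightarrow> 'o \<Rightarrow> bool" where
  "subprojective C M N \<longleftrightarrow>
     (\<forall>B \<in> Obj C. \<forall>g \<in> Hom C B N. epic C g \<longrightarrow>
        (\<forall>f \<in> Hom C M N. \<exists>h \<in> Hom C M B. g \<cdot>\<^bsub>C\<^esub> h = f))"

definition subprojectivity_domain :: "('o, 'a, 'm) category_scheme \<Rightarrow> 'o \<Rightarrow> 'o set" where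
  "subprojectivity_domain C M = {N \<in> Obj C. subprojective C M N}"

record ('o, 'a) preadditive_category = "('o, 'a) category" +
  Plus :: "'a \<Rightarrow> 'a \<Rightarrow> 'a"
  Zero :: "'o \<Rightarrow> 'o \<Rightarrow> 'a"

definition Hom_group ::
  "('o, 'a, 'm) preadditive_category_scheme \<Rightarrow> 'o \<Rightarrow> 'o \<Rightarrow> 'a monoid" where
  "Hom_group C A B = \<lparr>carrier = Hom C A B, monoid.mult = Plus C, one = Zero C A B\<rparr>"

text \<open>\<open>is_kernel C f k\<close> and \<open>is_cokernel C f c\<close> take the morphism \<open>f\<close> first and its
  (co)kernel second.\<close>

definition is_kernel :: "('o, 'a, 'm) preadditive_category_scheme \<Rightarrow> 'a \<Rightarrow> 'a \<Rightarrow> bool" where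
  "is_kernel C f k \<longleftrightarrow>
     f \<in> Arr C \<and> k \<in> Arr C \<and> Cod C k = Dom C f \<and>
     f \<cdot>\<^bsub>C\<^esub> k = Zero C (Dom C k) (Cod C f) \<and>
     (\<forall>X \<in> Obj C. \<forall>t \<in> Hom C X (Dom C f). f \<cdot>\<^bsub>C\<^esub> t = Zero C X (Cod C f) \<longrightarrow>
        (\<exists>!u. u \<in> Hom C X (Dom C k) \<and> k \<cdot>\<^bsub>C\<^esub> u = t))"

definition is_cokernel :: "('o, 'a, 'm) preadditive_category_scheme \<Rightarrow> 'a \<Rightarrow> 'a \<Rightarrow> bool" where
  "is_cokernel C f c \<longleftrightarrow>
     f \<in> Arr C \<and> c \<in> Arr C \<and> Dom C c = Cod C f \<and>
     c \<cdot>\<^bsub>C\<^esub> f = Zero C (Dom C f) (Cod C c) \<and>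
     (\<forall>X \<in> Obj C. \<forall>t \<in> Hom C (Cod C f) X. t \<cdot>\<^bsub>C\<^esub> f = Zero C (Dom C f) X \<longrightarrow>
        (\<exists>!u. u \<in> Hom C (Cod C c) X \<and> u \<cdot>\<^bsub>C\<^esub> c = t))"

locale preadditive_category = category C
  for C :: "('o, 'a, 'm) preadditive_category_scheme" (structure) +
  assumes Hom_comm_group: "A \<in> Obj C \<Longrightarrow> B \<in> Obj C \<Longrightarrow> comm_group (Hom_group C A B)"
    and Comp_Plus_left:
      "f \<in> Hom C X Y \<Longrightarrow> g \<in> Hom C Y Z \<Longrightarrow> h \<in> Hom C Y Z \<Longrightarrow>
         Plus C g h \<cdot> f = Plus C (g \<cdot> f) (h \<cdot> f)"
    and Comp_Plus_right:
      "f \<in> Hom C X Y \<Longrightarrow> g \<in> Hom C X Y \<Longrightarrow> h \<in> Hom C Y Z \<Longrightarrow>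
         h \<cdot> Plus C f g = Plus C (h \<cdot> f) (h \<cdot> g)"

text \<open>In a preadditive category binary products are automatically biproducts, so they are all
  that has to be required.\<close>

locale additive_category = preadditive_category C
  for C :: "('o, 'a, 'm) preadditive_category_scheme" (structure) +
  assumes zero_object: "\<exists>Z. is_zero_object C Z"
    and products: "A \<in> Obj C \<Longrightarrow> B \<in> Obj C \<Longrightarrow> \<exists>P p q. is_product C A B P p q"

locale abelian_category = additive_category C
  for C :: "('o, 'a, 'm) preadditive_category_scheme" (structure) +
  assumes kernels: "f \<in> Arr C \<Longrightarrow> \<exists>k. is_kernel C f k"
    and cokernels: "f \<in> Arr C \<Longrightarrow> \<exists>c. is_cokernel C f c"
    and monic_normal: "monic C f \<Longrightarrow> \<exists>g. is_kernel C g f"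
    and epic_conormal: "epic C f \<Longrightarrow> \<exists>g. is_cokernel C g f"

text \<open>Every cospan in an abelian category has a pullback, so a statement about ``the'' pullback
  may quantify universally over the triples satisfying \<^const>\<open>is_pullback\<close>.\<close>

lemma (in preadditive_category) Plus_closed:
  assumes "f \<in> Hom C X Y" "g \<in> Hom C X Y"
  shows "Plus C f g \<in> Hom C X Y"
proof -
  have "X \<in> Obj C" "Y \<in> Obj C"
    using assms Dom_closed Cod_closed by (auto simp: Hom_def)
  then interpret G: comm_group "Hom_group C X Y" by (rule Hom_comm_group)
  show ?thesis using G.m_closed assms by (simp add: Hom_group_def)
qed

lemma (in abelian_category) pullback_exists:
  assumes g: "g \<in> Hom C K B" and f: "f \<in> Hom C A B"
  shows "\<exists>D g' f'. is_pullback C g f D g' f'"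
proof -
  have ob: "A \<in> Obj C" "B \<in> Obj C" "K \<in> Obj C"
    using g f Dom_closed Cod_closed by (auto simp: Hom_def)
  obtain P p q where P: "is_product C A K P p q" using products ob by blast
  then have p: "p \<in> Hom C P A" and q: "q \<in> Hom C P K" by (auto simp: is_product_def)
  have P_ob: "P \<in> Obj C" using p Dom_closed by (auto simp: Hom_def)
  have fp: "f \<cdot> p \<in> Hom C P B" using Comp_closed p f by blast
  have gq: "g \<cdot> q \<in> Hom C P B" using Comp_closed q g by blast
  obtain n where n: "n \<in> Hom C P B" and n0: "Plus C (g \<cdot> q) n = Zero C P B"
  proof -
    interpret G: comm_group "Hom_group C P B" using Hom_comm_group P_ob ob by blast
    show ?thesis
      using that[of "inv\<^bsub>Hom_group C P B\<^esub> (g \<cdot> q)"] G.r_inv[of "g \<cdot> q"] G.inv_closed[of "g \<cdot> q"] gq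
      by (simp add: Hom_group_def)
  qed
  define s where "s = Plus C (f \<cdot> p) n"
  have s: "s \<in> Hom C P B" unfolding s_def using Plus_closed fp n by blast
  have key: "s \<cdot> t = Zero C X B \<longleftrightarrow> f \<cdot> (p \<cdot> t) = g \<cdot> (q \<cdot> t)" if t: "t \<in> Hom C X P" for X t
  proof -
    have X: "X \<in> Obj C" using t Dom_closed by (auto simp: Hom_def)
    interpret G: comm_group "Hom_group C X B" using Hom_comm_group X ob by blast
    interpret H: comm_group "Hom_group C P B" using Hom_comm_group P_ob ob by blast
    have Z: "Zero C P B \<in> Hom C P B" using H.one_closed by (simp add: Hom_group_def)
    have "Plus C (Zero C P B) (Zero C P B) = Zero C P B"
      using H.l_one[OF H.one_closed] by (simp add: Hom_group_def)
    then have "Plus C (Zero C P B \<cdot> t) (Zero C P B \<cdot> t) = Zero C P B \<cdot> t"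
      using Comp_Plus_left[OF t Z Z] by simp
    then have Zt: "Zero C P B \<cdot> t = Zero C X B"
      using G.l_cancel_one[of "Zero C P B \<cdot> t" "Zero C P B \<cdot> t"] Comp_closed[OF t Z]
      by (simp add: Hom_group_def)
    have a: "f \<cdot> p \<cdot> t \<in> Hom C X B" and b: "g \<cdot> q \<cdot> t \<in> Hom C X B" and c: "n \<cdot> t \<in> Hom C X B"
      using Comp_closed t p q f g n by blast+
    have bc: "Plus C (g \<cdot> q \<cdot> t) (n \<cdot> t) = Zero C X B"
      using Comp_Plus_left[OF t gq n] n0 Zt Comp_assoc[OF t q g] by simp
    have "s \<cdot> t = Plus C (f \<cdot> p \<cdot> t) (n \<cdot> t)"
      unfolding s_def using Comp_Plus_left[OF t fp n] Comp_assoc[OF t p f] by simp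
    then show ?thesis
      using bc a b c G.right_cancel[of "n \<cdot> t" "f \<cdot> p \<cdot> t" "g \<cdot> q \<cdot> t"] by (auto simp: Hom_group_def)
  qed
  obtain k where ker: "is_kernel C s k" using kernels s by (auto simp: Hom_def)
  define D where "D = Dom C k"
  have k: "k \<in> Hom C D P" using ker s by (auto simp: is_kernel_def Hom_def D_def)
  have sk: "s \<cdot> k = Zero C D B" using ker s by (auto simp: is_kernel_def Hom_def D_def)
  have univ: "\<exists>!u. u \<in> Hom C X D \<and> (p \<cdot> k) \<cdot> u = a \<and> (q \<cdot> k) \<cdot> u = c"
    if X: "X \<in> Obj C" and a: "a \<in> Hom C X A" and c: "c \<in> Hom C X K" and e: "f \<cdot> a = g \<cdot> c" for X a c
  proof -
    have Pu: "\<exists>!t. t \<in> Hom C X P \<and> p \<cdot> t = a \<and> q \<cdot> t = c"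
      using P X a c by (simp add: is_product_def)
    then obtain t where t: "t \<in> Hom C X P" "p \<cdot> t = a" "q \<cdot> t = c" by blast
    then have "s \<cdot> t = Zero C X B" using key e by blast
    then have Ku: "\<exists>!u. u \<in> Hom C X D \<and> k \<cdot> u = t"
      using ker X s t unfolding is_kernel_def D_def by (auto simp: Hom_def)
    have "((p \<cdot> k) \<cdot> u = a \<and> (q \<cdot> k) \<cdot> u = c) \<longleftrightarrow> k \<cdot> u = t" if u: "u \<in> Hom C X D" for u
      using Pu t Comp_assoc[OF u k p] Comp_assoc[OF u k q] Comp_closed[OF u k] by auto
    then show ?thesis using Ku by (metis (no_types, lifting))
  qed
  have ends: "g \<in> Arr C" "f \<in> Arr C" "Dom C g = K" "Cod C g = B" "Dom C f = A" "Cod C f = B"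
    using g f by (auto simp: Hom_def)
  have "f \<cdot> (p \<cdot> k) = g \<cdot> (q \<cdot> k)" using key[OF k] sk by simp
  then have "is_pullback C g f D (p \<cdot> k) (q \<cdot> k)"
    unfolding is_pullback_def ends
    using ends univ Comp_closed[OF k p] Comp_closed[OF k q] by simp
  then show ?thesis by blast
qed

end

theory Submission
  imports Defs
begin

text \<open>The universal property of the pullback of \<open>g\<close> and \<open>f\<close> turns sections of \<open>g'\<close> into lifts of
  \<open>f\<close> through \<open>g\<close>, so each condition says that certain morphisms lift. For the implication from 4
  to 1, cover \<open>P\<close> by a projective \<open>Q\<close>: a morphism \<open>M \<rightarrow> N\<close> lifts to \<open>P\<close> by the splitting, then to
  \<open>Q\<close> because \<open>P\<close> lies in the domain of \<open>M\<close>, and the composite \<open>Q \<rightarrow> P \<rightarrow> N\<close> lifts through any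
  epimorphism onto \<open>N\<close>. This avoids stability of epimorphisms under pullback.\<close>

context category
begin

text \<open>\<open>split_epic\<close> asks for \<open>epic\<close> besides the section. Composing
  \<open>u \<cdot> g = v \<cdot> g\<close> with \<open>k\<close> on the right cancels
  \<open>g\<close>, so the section alone yields both.\<close>

lemma split_epicI:
  assumes g: "g \<in> Hom C X Y" and k: "k \<in> Hom C Y X" and gk: "g \<cdot> k = Ide C Y"
  shows "split_epic C g"
proof -
  have ends: "g \<in> Arr C" "Dom C g = X" "Cod C g = Y" using g by (auto simp: Hom_def)
  have "u = v" if u: "u \<in> Hom C Y Z" and v: "v \<in> Hom C Y Z" and e: "u \<cdot> g = v \<cdot> g" for Z u v
  proof -
    have "u = (u \<cdot> g) \<cdot> k" by (simp only: Comp_assoc[OF k g u] gk Comp_Ide[OF u])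
    also have "\<dots> = v" by (simp only: e Comp_assoc[OF k g v] gk Comp_Ide[OF v])
    finally show ?thesis .
  qed
  then have "epic C g" by (simp add: epic_def ends)
  then show ?thesis using k gk by (auto simp: split_epic_def ends)
qed

text \<open>A section \<open>k\<close> of \<open>g'\<close> gives the lift
  \<open>f' \<cdot> k\<close>. Conversely, a lift \<open>h\<close> and the identity of
  \<open>M\<close> form a cone over the cospan, and its mediating morphism is a section of
  \<open>g'\<close>.\<close>

lemma pullback_split_epic_iff_lift:
  assumes g: "g \<in> Hom C K N" and f: "f \<in> Hom C M N" and pb: "is_pullback C g f D g' f'"
  shows "split_epic C g' \<longleftrightarrow> (\<exists>h \<in> Hom C M K. g \<cdot> h = f)"
proof
  have ends: "Dom C g = K" "Dom C f = M" using g f by (auto simp: Hom_def)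
  have g': "g' \<in> Hom C D M" and f': "f' \<in> Hom C D K" and sq: "f \<cdot> g' = g \<cdot> f'"
    and univ: "\<And>X a c. X \<in> Obj C \<Longrightarrow> a \<in> Hom C X M \<Longrightarrow> c \<in> Hom C X K \<Longrightarrow> f \<cdot> a = g \<cdot> c \<Longrightarrow>
      \<exists>u \<in> Hom C X D. g' \<cdot> u = a \<and> f' \<cdot> u = c"
    using pb unfolding is_pullback_def ends by blast+
  {
    assume "split_epic C g'"
    then obtain k where k: "k \<in> Hom C M D" "g' \<cdot> k = Ide C M"
      using g' by (auto simp: split_epic_def Hom_def)
    have "g \<cdot> (f' \<cdot> k) = f"
      using Comp_assoc[OF k(1) f' g] Comp_assoc[OF k(1) g' f] sq k(2) Comp_Ide[OF f] by simp
    then show "\<exists>h \<in> Hom C M K. g \<cdot> h = f" using Comp_closed[OF k(1) f'] by blast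
  next
    assume "\<exists>h \<in> Hom C M K. g \<cdot> h = f"
    then obtain h where h: "h \<in> Hom C M K" "g \<cdot> h = f" by blast
    have M: "M \<in> Obj C" using f Dom_closed by (auto simp: Hom_def)
    obtain u where "u \<in> Hom C M D" "g' \<cdot> u = Ide C M"
      using univ[OF M Ide_closed[OF M] h(1)] h(2) Comp_Ide[OF f] by auto
    then show "split_epic C g'" using split_epicI[OF g'] by blast
  }
qed

text \<open>Projectivity lifts the identity of \<open>P\<close> to a section \<open>s\<close> of
  \<open>g\<close>, and then \<open>s \<cdot> f\<close> lifts \<open>f\<close>. This leads from
  condition 3 to condition 4.\<close>

lemma projective_imp_subprojectivity_domain:
  assumes proj: "projective C P"
  shows "P \<in> subprojectivity_domain C M"
proof -
  have P: "P \<in> Obj C" using proj by (simp add: projective_def)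
  have "\<exists>h \<in> Hom C M B. g \<cdot> h = f"
    if B: "B \<in> Obj C" and g: "g \<in> Hom C B P" "epic C g" and f: "f \<in> Hom C M P" for B g f
  proof -
    obtain s where s: "s \<in> Hom C P B" "g \<cdot> s = Ide C P"
      using proj P B g Ide_closed[OF P] unfolding projective_def by blast
    have "g \<cdot> (s \<cdot> f) = f"
      using Comp_assoc[OF f s(1) g(1)] s(2) Ide_Comp[OF f] by simp
    then show ?thesis using Comp_closed[OF f s(1)] by blast
  qed
  then show ?thesis using P by (simp add: subprojectivity_domain_def subprojective_def)
qed

text \<open>The detour through \<open>Q\<close> is there because membership of \<open>P\<close> in
  the domain lifts only morphisms from \<open>M\<close> to \<open>P\<close>; it gives no lift of
  \<open>g\<close> itself through \<open>e\<close>, whereas \<open>g \<cdot> q\<close> starts at a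
  projective object.\<close>

lemma subprojectivity_domain_lift_cover:
  assumes enough: "enough_projectives C" and P: "P \<in> subprojectivity_domain C M"
    and g: "g \<in> Hom C P N" and lift: "\<And>f. f \<in> Hom C M N \<Longrightarrow> \<exists>h \<in> Hom C M P. g \<cdot> h = f"
  shows "N \<in> subprojectivity_domain C M"
proof -
  have N: "N \<in> Obj C" using g Cod_closed by (auto simp: Hom_def)
  have P_ob: "P \<in> Obj C" and sub: "subprojective C M P"
    using P by (auto simp: subprojectivity_domain_def)
  obtain Q q where Q: "projective C Q" and q: "q \<in> Hom C Q P" "epic C q"
    using enough P_ob unfolding enough_projectives_def by blast
  have Q_ob: "Q \<in> Obj C" using Q by (simp add: projective_def)
  have "\<exists>h \<in> Hom C M B. e \<cdot> h = f"
    if B: "B \<in> Obj C" and e: "e \<in> Hom C B N" "epic C e" and f: "f \<in> Hom C M N" for B e f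
  proof -
    obtain h where h: "h \<in> Hom C M P" "g \<cdot> h = f" using lift f by blast
    obtain j where j: "j \<in> Hom C M Q" "q \<cdot> j = h"
      using sub Q_ob q h(1) unfolding subprojective_def by blast
    obtain l where l: "l \<in> Hom C Q B" "e \<cdot> l = g \<cdot> q"
      using Q B N e Comp_closed[OF q(1) g] unfolding projective_def by blast
    have "e \<cdot> (l \<cdot> j) = f"
      using Comp_assoc[OF j(1) l(1) e(1)] Comp_assoc[OF j(1) q(1) g] l(2) j(2) h(2) by simp
    then show ?thesis using Comp_closed[OF j(1) l(1)] by blast
  qed
  then show ?thesis using N by (simp add: subprojectivity_domain_def subprojective_def)
qed

end

text \<open>Existence of a pullback keeps the quantifier over \<open>D\<close>, \<open>g'\<close>,
  \<open>f'\<close> from being vacuous: one split pullback provides a lift, and a lift splits every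
  pullback.\<close>

lemma (in abelian_category) pullbacks_split_iff_lifts:
  assumes g: "g \<in> Hom C K N"
  shows "(\<forall>f \<in> Hom C M N. \<forall>D g' f'. is_pullback C g f D g' f' \<longrightarrow> split_epic C g') \<longleftrightarrow>
    (\<forall>f \<in> Hom C M N. \<exists>h \<in> Hom C M K. g \<cdot> h = f)"
proof (rule ball_cong[OF refl])
  fix f assume f: "f \<in> Hom C M N"
  obtain D g' f' where "is_pullback C g f D g' f'" using pullback_exists[OF g f] by blast
  then show "(\<forall>D g' f'. is_pullback C g f D g' f' \<longrightarrow> split_epic C g') \<longleftrightarrow>
      (\<exists>h \<in> Hom C M K. g \<cdot> h = f)"
    using pullback_split_epic_iff_lift[OF g f] by blast
qed

theorem proposition3p1:
  fixes C :: "('o, 'a) preadditive_category" and M N :: 'o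
  assumes "abelian_category C" and "enough_projectives C"
    and "M \<in> Obj C" and "N \<in> Obj C"
  shows "let
      c1 = N \<in> subprojectivity_domain C M;
      c2 = (\<forall>K \<in> Obj C. \<forall>g \<in> Hom C K N. epic C g \<longrightarrow>
              (\<forall>f \<in> Hom C M N. \<forall>D g' f'. is_pullback C g f D g' f' \<longrightarrow> split_epic C g'));
      c3 = (\<exists>P \<in> Obj C. \<exists>g \<in> Hom C P N. epic C g \<and> projective C P \<and>
              (\<forall>f \<in> Hom C M N. \<forall>D g' f'. is_pullback C g f D g' f' \<longrightarrow> split_epic C g'));
      c4 = (\<exists>P \<in> Obj C. \<exists>g \<in> Hom C P N. epic C g \<and> P \<in> subprojectivity_domain C M \<and>
              (\<forall>f \<in> Hom C M N. \<forall>D g' f'. is_pullback C g f D g' f' \<longrightarrow> split_epic C g'))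
    in (c1 \<longleftrightarrow> c2) \<and> (c2 \<longleftrightarrow> c3) \<and> (c3 \<longleftrightarrow> c4)"
proof -
  interpret abelian_category C by fact
  let ?split = "\<lambda>g. \<forall>f \<in> Hom C M N. \<forall>D g' f'. is_pullback C g f D g' f' \<longrightarrow> split_epic C g'"
  define c1 where "c1 \<longleftrightarrow> N \<in> subprojectivity_domain C M"
  define c2 where "c2 \<longleftrightarrow> (\<forall>K \<in> Obj C. \<forall>g \<in> Hom C K N. epic C g \<longrightarrow> ?split g)"
  define c3 where "c3 \<longleftrightarrow> (\<exists>P \<in> Obj C. \<exists>g \<in> Hom C P N. epic C g \<and> projective C P \<and> ?split g)"
  define c4 where "c4 \<longleftrightarrow>
    (\<exists>P \<in> Obj C. \<exists>g \<in> Hom C P N. epic C g \<and> P \<in> subprojectivity_domain C M \<and> ?split g)"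
  have 12: "c1 \<longleftrightarrow> c2"
  proof -
    \<comment> \<open>Once splitting is replaced by lifting for each \<open>g\<close>,
      \<open>c2\<close> is the definition of \<open>subprojective\<close>.\<close>
    have "c2 \<longleftrightarrow> subprojective C M N"
      unfolding c2_def subprojective_def
      by (intro ball_cong refl imp_cong pullbacks_split_iff_lifts)
    then show ?thesis using assms(4) by (simp add: c1_def subprojectivity_domain_def)
  qed
  have 23: c3 if 2: c2
  proof -
    \<comment> \<open>A projective cover of \<open>N\<close> in the weak sense, an epimorphism from
      a projective, is one of the epimorphisms that \<open>c2\<close> speaks of.\<close>
    obtain P p where "projective C P" "p \<in> Hom C P N" "epic C p"
      using assms(2,4) unfolding enough_projectives_def by blast
    moreover from this have "P \<in> Obj C" by (simp add: projective_def)
    ultimately show ?thesis using 2 unfolding c2_def c3_def by blast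
  qed
  have 34: c4 if c3
    using that projective_imp_subprojectivity_domain unfolding c3_def c4_def by blast
  have 41: c1 if 4: c4
  proof -
    obtain P g where P: "P \<in> subprojectivity_domain C M" and g: "g \<in> Hom C P N" and "?split g"
      using 4 unfolding c4_def by blast
    then have "\<forall>f \<in> Hom C M N. \<exists>h \<in> Hom C M P. g \<cdot>\<^bsub>C\<^esub> h = f"
      using pullbacks_split_iff_lifts by blast
    then show ?thesis
      unfolding c1_def using subprojectivity_domain_lift_cover[OF assms(2) P g] by blast
  qed
  \<comment> \<open>The implications close the cycle from 2 to 3 to 4 to 1, and 1 is equivalent to
    2.\<close>
  have "(c1 \<longleftrightarrow> c2) \<and> (c2 \<longleftrightarrow> c3) \<and> (c3 \<longleftrightarrow> c4)" using 12 23 34 41 by blast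
  then show ?thesis unfolding Let_def c1_def c2_def c3_def c4_def .
qed

end
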